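(* Let $\mathbb{K}$ be a field with $\operatorname{char}(\mathbb{K})=0$, let $G$ be a finite group acting on a nonempty set $E$, and let $D=G\times E$ be the associated generalized digroup. Let $$0\longrightarrow W\stackrel{\iota}{\longrightarrow}V\stackrel{\pi}{\longrightarrow}Q\longrightarrow 0$$ be a short exact sequence in the category $\mathsf{Rep}(D)$ of representations of $D$ over $\mathbb{K}$. Then there exists a $\mathbb{K}$-linear map $s:Q\to V$ such that $\pi\circ s=\mathrm{id}_Q$ and $\rho_x\circ s=s\circ\rho_x^Q$ for all $x\in D$, where $\rho$ and $\rho^Q$ denote the $\rho$-operators of $V$ and $Q$.
   Context: Let $G$ be a group with identity $1$ acting on the left on a nonempty set $E$, $(g,\alpha)\mapsto g\bullet\alpha$. The associated generalized digroup is the set $D=G\times E$ with operations $(g,\alpha)\vdash(h,\beta)=(gh,g\bullet\beta)$, $(g,\alpha)\dashv(h,\beta)=(gh,\alpha)$ and halo $\overline{E}=\{(1,\alpha)\mid\alpha\in E\}$. (Every generalized digroup is isomorphic to one of this form.) A representation of $D$ over $\mathbb{K}$ is a triple $(V,\lambda,\rho)$ where $V$ is a $\mathbb{K}$-vector space and $\lambda:D\to\operatorname{End}(V)$, $\rho:D\to\operatorname{Aut}(V)$ are maps such that for all $x,y\in D$ and $e\in\overline{E}$: $\lambda_{x\dashv y}=\lambda_x\lambda_y$, $\rho_{x\vdash y}=\rho_x\rho_y$, $\rho_e=\mathrm{id}_V$, $\rho_x\lambda_y=\lambda_{x\vdash y}$, $\lambda_x\rho_y=\lambda_{x\dashv y}$.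 A morphism of representations is a $\mathbb{K}$-linear map commuting with all $\lambda_x$ and all $\rho_x$, $x\in D$. These form the abelian category $\mathsf{Rep}(D)$; exactness is exactness of underlying vector spaces. *)

theory Defs
  imports Complex_Main "HOL-Algebra.Group_Action"
begin

record 'd digroup = "'d partial_object" +
  lprod :: "'d \<Rightarrow> 'd \<Rightarrow> 'd"  (infixl \<open>\<turnstile>\<index>\<close> 70)
  rprod :: "'d \<Rightarrow> 'd \<Rightarrow> 'd"  (infixl \<open>\<stileturn>\<index>\<close> 70)
  halo  :: "'d set"

text \<open>The action is given as in \<^locale>\<open>group_action\<close>: \<open>\<phi> g \<alpha>\<close> is \<open>g\<close> acting on \<open>\<alpha>\<close> from the left.\<close>

definition action_digroup ::
  "('g, 'm) monoid_scheme \<Rightarrow> 'e set \<Rightarrow> ('g \<Rightarrow> 'e \<Rightarrow> 'e) \<Rightarrow> ('g \<times> 'e) digroup" where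
  "action_digroup G E \<phi> =
    \<lparr> carrier = carrier G \<times> E,
      lprod = (\<lambda>(g, \<alpha>) (h, \<beta>). (g \<otimes>\<^bsub>G\<^esub> h, \<phi> g \<beta>)),
      rprod = (\<lambda>(g, \<alpha>) (h, \<beta>). (g \<otimes>\<^bsub>G\<^esub> h, \<alpha>)),
      halo = {(\<one>\<^bsub>G\<^esub>, \<alpha>) | \<alpha>. \<alpha> \<in> E} \<rparr>"

text \<open>The underlying vector space is the whole type \<open>'v\<close>, with scalar multiplication \<open>scal\<close>.\<close>

record ('k, 'd, 'v) digroup_rep =
  scal :: "'k \<Rightarrow> 'v \<Rightarrow> 'v"
  lam  :: "'d \<Rightarrow> 'v \<Rightarrow> 'v"
  rho  :: "'d \<Rightarrow> 'v \<Rightarrow> 'v"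

locale representation =
  fixes D :: "'d digroup" (structure)
    and V :: "('k::field, 'd, 'v::ab_group_add) digroup_rep"
  assumes vector_space: "vector_space (scal V)"
    and lam_End: "x \<in> carrier D \<Longrightarrow> Vector_Spaces.linear (scal V) (scal V) (lam V x)"
    and rho_End: "x \<in> carrier D \<Longrightarrow> Vector_Spaces.linear (scal V) (scal V) (rho V x)"
    and rho_bij: "x \<in> carrier D \<Longrightarrow> bij (rho V x)"
    and lam_rprod: "\<lbrakk>x \<in> carrier D; y \<in> carrier D\<rbrakk> \<Longrightarrow> lam V (x \<stileturn> y) = lam V x \<circ> lam V y"
    and rho_lprod: "\<lbrakk>x \<in> carrier D; y \<in> carrier D\<rbrakk> \<Longrightarrow> rho V (x \<turnstile> y) = rho V x \<circ> rho V y"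
    and rho_halo: "e \<in> halo D \<Longrightarrow> rho V e = id"
    and rho_lam: "\<lbrakk>x \<in> carrier D; y \<in> carrier D\<rbrakk> \<Longrightarrow> rho V x \<circ> lam V y = lam V (x \<turnstile> y)"
    and lam_rho: "\<lbrakk>x \<in> carrier D; y \<in> carrier D\<rbrakk> \<Longrightarrow> lam V x \<circ> rho V y = lam V (x \<stileturn> y)"

definition rep_hom ::
  "'d digroup \<Rightarrow> ('k::field, 'd, 'v::ab_group_add) digroup_rep
    \<Rightarrow> ('k, 'd, 'w::ab_group_add) digroup_rep \<Rightarrow> ('v \<Rightarrow> 'w) \<Rightarrow> bool" where
  "rep_hom D V W f \<longleftrightarrow>
    Vector_Spaces.linear (scal V) (scal W) f \<and>
    (\<forall>x\<in>carrier D. f \<circ> lam V x = lam W x \<circ> f \<and> f \<circ> rho V x = rho W x \<circ> f)"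

definition short_exact_reps ::
  "'d digroup \<Rightarrow> ('k::field, 'd, 'w::ab_group_add) digroup_rep
    \<Rightarrow> ('k, 'd, 'v::ab_group_add) digroup_rep \<Rightarrow> ('k, 'd, 'q::ab_group_add) digroup_rep
    \<Rightarrow> ('w \<Rightarrow> 'v) \<Rightarrow> ('v \<Rightarrow> 'q) \<Rightarrow> bool" where
  "short_exact_reps D W V Q \<iota> \<pi> \<longleftrightarrow>
    representation D W \<and> representation D V \<and> representation D Q \<and>
    rep_hom D W V \<iota> \<and> rep_hom D V Q \<pi> \<and>
    inj \<iota> \<and> range \<iota> = {v. \<pi> v = 0} \<and> surj \<pi>"

end

theory Submission
  imports Defs
begin

text \<open>
  The halo makes the \<open>\<rho>\<close>-operators of a representation of \<open>D = G \<times> E\<close> forget the coordinate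
  in \<open>E\<close>: since \<open>(g, \<alpha>) \<turnstile> (1, \<beta>) = (g, g \<bullet> \<beta>)\<close> and \<open>\<rho>\<close> is trivial at \<open>(1, \<beta>)\<close>, the operator at
  \<open>(g, \<alpha>)\<close> equals the one at \<open>(g, g \<bullet> \<beta>)\<close>, whatever \<open>\<alpha>\<close> is (\<open>rho_independent\<close>). Hence \<open>\<rho>\<close> is
  nothing but a linear representation of the group \<open>G\<close> (\<open>rho_group_hom\<close>), and \<open>\<pi>\<close> is an
  equivariant surjection. Maschke's argument (\<open>equivariant_section\<close>) then applies: any linear
  section \<open>t\<close> of \<open>\<pi>\<close> becomes equivariant when it is replaced by the average over \<open>g\<close> of the
  conjugates of \<open>t\<close> by the action of \<open>g\<close> on both sides, where dividing by the order of \<open>G\<close> is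
  possible in characteristic \<open>0\<close>.
\<close>

lemma (in group) sum_left_translate:
  fixes f :: "'a \<Rightarrow> 'v::comm_monoid_add"
  assumes h: "h \<in> carrier G"
  shows "(\<Sum>g\<in>carrier G. f (h \<otimes> g)) = (\<Sum>g\<in>carrier G. f g)"
  by (rule sum.reindex_bij_witness[of _ "\<lambda>g. inv h \<otimes> g" "\<lambda>g. h \<otimes> g"])
     (use h in \<open>auto simp: m_assoc[symmetric]\<close>)

text \<open>
  Each conjugate of a linear section is again a section, because \<open>p\<close> is equivariant; so their
  average is one too. The average is equivariant because conjugating it by \<open>h\<close> only permutes
  the summands. The condition on the order also makes the group finite, since an infinite set
  has cardinality \<open>0\<close>.
\<close>

lemma (in group) equivariant_section:
  fixes sV :: "'k::field \<Rightarrow> 'v::ab_group_add \<Rightarrow> 'v"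
    and sQ :: "'k \<Rightarrow> 'q::ab_group_add \<Rightarrow> 'q"
    and R :: "'a \<Rightarrow> 'v \<Rightarrow> 'v" and S :: "'a \<Rightarrow> 'q \<Rightarrow> 'q"
  assumes order: "(of_nat (card (carrier G)) :: 'k) \<noteq> 0"
    and R_linear: "\<And>g. g \<in> carrier G \<Longrightarrow> Vector_Spaces.linear sV sV (R g)"
    and R_mult: "\<And>g h. g \<in> carrier G \<Longrightarrow> h \<in> carrier G \<Longrightarrow> R (g \<otimes> h) = R g \<circ> R h"
    and S_linear: "\<And>g. g \<in> carrier G \<Longrightarrow> Vector_Spaces.linear sQ sQ (S g)"
    and S_mult: "\<And>g h. g \<in> carrier G \<Longrightarrow> h \<in> carrier G \<Longrightarrow> S (g \<otimes> h) = S g \<circ> S h"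
    and S_one: "S \<one> = id"
    and p_linear: "Vector_Spaces.linear sV sQ p"
    and p_surj: "surj p"
    and p_equivariant: "\<And>g. g \<in> carrier G \<Longrightarrow> p \<circ> R g = S g \<circ> p"
  shows "\<exists>s. Vector_Spaces.linear sQ sV s \<and> p \<circ> s = id \<and>
    (\<forall>g\<in>carrier G. R g \<circ> s = s \<circ> S g)"
proof -
  interpret p: Vector_Spaces.linear sV sQ p by (rule p_linear)
  interpret VQ: vector_space_pair sV sQ ..
  interpret QV: vector_space_pair sQ sV ..
  obtain t where t: "Vector_Spaces.linear sQ sV t" and pt: "p \<circ> t = id"
    using VQ.linear_surjective_right_inverse[OF p_linear p_surj] by blast
  define A where "A q = (\<Sum>g\<in>carrier G. R g (t (S (inv g) q)))" for q
  define n where "n = (of_nat (card (carrier G)) :: 'k)"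
  define s where "s q = sV (inverse n) (A q)" for q
  have conj_linear: "Vector_Spaces.linear sQ sV (\<lambda>q. R g (t (S (inv g) q)))"
    if g: "g \<in> carrier G" for g
    using Vector_Spaces.linear_compose[OF Vector_Spaces.linear_compose[OF S_linear t] R_linear,
        OF inv_closed[OF g] g]
    by (simp add: o_def)
  have A_linear: "Vector_Spaces.linear sQ sV A"
    unfolding A_def by (rule QV.linear_compose_sum) (use conj_linear in blast)
  have s_linear: "Vector_Spaces.linear sQ sV s"
    unfolding s_def by (rule QV.linear_compose_scale_right[OF A_linear])
  have pA: "p (A q) = sQ n q" for q
  proof -
    have "p (R g (t (S (inv g) q))) = q" if g: "g \<in> carrier G" for g
    proof -
      have "p (R g (t (S (inv g) q))) = S g (p (t (S (inv g) q)))"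
        using fun_cong[OF p_equivariant[OF g]] by simp
      also have "\<dots> = S g (S (inv g) q)"
        using fun_cong[OF pt] by simp
      also have "\<dots> = S (g \<otimes> inv g) q"
        by (simp only: S_mult[OF g inv_closed[OF g]] o_apply)
      finally show ?thesis
        using g by (simp add: S_one)
    qed
    then have "p (A q) = (\<Sum>g\<in>carrier G. q)"
      unfolding A_def p.sum by simp
    also have "\<dots> = sQ n q"
      by (simp add: n_def p.vs2.sum_constant_scale)
    finally show ?thesis .
  qed
  have ps: "p \<circ> s = id"
    using order by (simp add: fun_eq_iff s_def p.scale pA n_def)
  have A_equivariant: "R h (A q) = A (S h q)" if h: "h \<in> carrier G" for h q
  proof -
    interpret R: Vector_Spaces.linear sV sV "R h" by (rule R_linear[OF h])
    have "R h (A q) = (\<Sum>g\<in>carrier G. R h (R g (t (S (inv g) q))))"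
      unfolding A_def by (rule R.sum)
    also have "\<dots> = (\<Sum>g\<in>carrier G. R (h \<otimes> g) (t (S (inv (h \<otimes> g)) (S h q))))"
    proof (rule sum.cong[OF refl])
      fix g assume g: "g \<in> carrier G"
      have "S (inv (h \<otimes> g)) (S h q) = S (inv (h \<otimes> g) \<otimes> h) q"
        by (simp only: S_mult[OF inv_closed[OF m_closed[OF h g]] h] o_apply)
      also have "inv (h \<otimes> g) \<otimes> h = inv g"
        using g h by (simp add: inv_mult_group m_assoc)
      finally show "R h (R g (t (S (inv g) q))) = R (h \<otimes> g) (t (S (inv (h \<otimes> g)) (S h q)))"
        using g h by (simp add: R_mult)
    qed
    also have "\<dots> = A (S h q)"
      unfolding A_def by (rule sum_left_translate[OF h])
    finally show ?thesis .
  qed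
  have "R h \<circ> s = s \<circ> S h" if h: "h \<in> carrier G" for h
  proof -
    interpret R: Vector_Spaces.linear sV sV "R h" by (rule R_linear[OF h])
    show ?thesis
      by (simp add: fun_eq_iff s_def R.scale A_equivariant[OF h])
  qed
  with s_linear ps show ?thesis by blast
qed

text \<open>
  Right multiplication by one fixed halo element sends \<open>(g, \<alpha>)\<close> and \<open>(g, \<beta>)\<close> to the same
  element of \<open>D\<close> and preserves \<open>\<rho>\<close>.
\<close>

lemma rho_independent:
  assumes act: "group_action G E \<phi>" and rep: "representation (action_digroup G E \<phi>) V"
    and g: "g \<in> carrier G" and \<alpha>: "\<alpha> \<in> E" and \<beta>: "\<beta> \<in> E"
  shows "rho V (g, \<alpha>) = rho V (g, \<beta>)"
proof -
  interpret group_action G E \<phi> by (rule act)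
  interpret G: group G by (rule group_hom.axioms(1)[OF group_hom])
  have "rho V (g, \<gamma>) = rho V (g, \<phi> g \<alpha>)" if "\<gamma> \<in> E" for \<gamma>
    using representation.rho_lprod[OF rep, of "(g, \<gamma>)" "(\<one>\<^bsub>G\<^esub>, \<alpha>)"]
      representation.rho_halo[OF rep, of "(\<one>\<^bsub>G\<^esub>, \<alpha>)"] g \<alpha> that
    by (simp add: action_digroup_def)
  with \<alpha> \<beta> show ?thesis by metis
qed

text \<open>
  The product \<open>(g, \<alpha>) \<turnstile> (h, \<alpha>)\<close> has second coordinate \<open>g \<bullet> \<alpha>\<close>, so a slice \<open>G \<times> {\<alpha>}\<close> need not be
  closed under it; independence of the second coordinate leads back to the slice.
\<close>

lemma rho_group_hom:
  assumes act: "group_action G E \<phi>" and rep: "representation (action_digroup G E \<phi>) V"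
    and g: "g \<in> carrier G" and h: "h \<in> carrier G" and \<alpha>: "\<alpha> \<in> E"
  shows "rho V (g \<otimes>\<^bsub>G\<^esub> h, \<alpha>) = rho V (g, \<alpha>) \<circ> rho V (h, \<alpha>)"
proof -
  interpret group_action G E \<phi> by (rule act)
  interpret G: group G by (rule group_hom.axioms(1)[OF group_hom])
  have "rho V (g \<otimes>\<^bsub>G\<^esub> h, \<alpha>) = rho V (g \<otimes>\<^bsub>G\<^esub> h, \<phi> g \<alpha>)"
    using g h \<alpha> by (intro rho_independent[OF act rep]) (auto intro: element_image)
  then show ?thesis
    using representation.rho_lprod[OF rep, of "(g, \<alpha>)" "(h, \<alpha>)"] g h \<alpha>
    by (simp add: action_digroup_def)
qed

theorem proposition28:
  fixes G :: "('g, 'm) monoid_scheme" and E :: "'e set" and \<phi> :: "'g \<Rightarrow> 'e \<Rightarrow> 'e"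
    and W :: "('k::field_char_0, 'g \<times> 'e, 'w::ab_group_add) digroup_rep"
    and V :: "('k, 'g \<times> 'e, 'v::ab_group_add) digroup_rep"
    and Q :: "('k, 'g \<times> 'e, 'q::ab_group_add) digroup_rep"
    and \<iota> :: "'w \<Rightarrow> 'v" and \<pi> :: "'v \<Rightarrow> 'q"
  assumes "group_action G E \<phi>" and "finite (carrier G)" and "E \<noteq> {}"
    and "short_exact_reps (action_digroup G E \<phi>) W V Q \<iota> \<pi>"
  shows "\<exists>s. Vector_Spaces.linear (scal Q) (scal V) s \<and> \<pi> \<circ> s = id \<and>
    (\<forall>x\<in>carrier (action_digroup G E \<phi>). rho V x \<circ> s = s \<circ> rho Q x)"
proof -
  interpret group_action G E \<phi> by (rule assms(1))
  interpret G: group G by (rule group_hom.axioms(1)[OF group_hom])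
  from assms(4) have V: "representation (action_digroup G E \<phi>) V"
    and Q: "representation (action_digroup G E \<phi>) Q"
    and hom: "rep_hom (action_digroup G E \<phi>) V Q \<pi>" and surj: "surj \<pi>"
    by (auto simp: short_exact_reps_def)
  \<comment> \<open>Restricted to the slice over any base point \<open>e\<close>, the operators \<open>\<rho>\<close> represent \<open>G\<close>.\<close>
  obtain e where e: "e \<in> E" using assms(3) by blast
  have mem: "(g, e) \<in> carrier (action_digroup G E \<phi>)" if "g \<in> carrier G" for g
    using that e by (simp add: action_digroup_def)
  have one: "(\<one>\<^bsub>G\<^esub>, e) \<in> halo (action_digroup G E \<phi>)"
    using e by (simp add: action_digroup_def)
  have "\<exists>s. Vector_Spaces.linear (scal Q) (scal V) s \<and> \<pi> \<circ> s = id \<and>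
    (\<forall>g\<in>carrier G. rho V (g, e) \<circ> s = s \<circ> rho Q (g, e))"
  proof (rule G.equivariant_section)
    show "(of_nat (card (carrier G)) :: 'k) \<noteq> 0"
      using assms(2) G.one_closed by (auto simp: card_eq_0_iff)
    show "Vector_Spaces.linear (scal V) (scal Q) \<pi>"
      using hom by (simp add: rep_hom_def)
    show "\<pi> \<circ> rho V (g, e) = rho Q (g, e) \<circ> \<pi>" if "g \<in> carrier G" for g
      using hom mem[OF that] by (simp add: rep_hom_def)
  qed (fact surj representation.rho_halo[OF Q one]
      | (rule representation.rho_End[OF V mem] representation.rho_End[OF Q mem]
           rho_group_hom[OF assms(1) V] rho_group_hom[OF assms(1) Q]; (assumption | rule e)))+
  then obtain s where s: "Vector_Spaces.linear (scal Q) (scal V) s" "\<pi> \<circ> s = id"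
    and eq: "\<And>g. g \<in> carrier G \<Longrightarrow> rho V (g, e) \<circ> s = s \<circ> rho Q (g, e)"
    by blast
  have "rho V x \<circ> s = s \<circ> rho Q x" if x: "x \<in> carrier (action_digroup G E \<phi>)" for x
  proof -
    obtain g \<alpha> where g: "g \<in> carrier G" and \<alpha>: "\<alpha> \<in> E" and x_eq: "x = (g, \<alpha>)"
      using x by (auto simp: action_digroup_def)
    show ?thesis
      using eq[OF g] rho_independent[OF assms(1) V g \<alpha> e] rho_independent[OF assms(1) Q g \<alpha> e]
      by (simp add: x_eq)
  qed
  with s show ?thesis by blast
qed

end
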